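(* The map $\pi$ is a bijection from the set of alternating arc diagrams on $n+1$ points to the set of pairs $(S,T)$ of subsets of $[n]=\{1,\dots,n\}$ with $|S|=|T|$. For each $k$, it restricts to a bijection from alternating arc diagrams with $k$ arcs to pairs of $k$-element subsets of $[n]$.
   Context: Place points $1,\dots,n+1$ on a vertical line from bottom to top. An arc connects two points $i<j$, moving monotonically upward and passing either to the left or to the right of each point $p$ with $i<p<j$. A noncrossing arc diagram is a set of arcs such that no two arcs intersect in their interiors, no two arcs share an upper endpoint, and no two arcs share a lower endpoint; diagrams are considered up to combinatorics (which endpoints are joined and on which side of each intermediate point each arc passes). An arc is right-even alternating if it passes right of every even intermediate point and left of every odd one; left-even alternating if it passes left of every even and right of every odd intermediate point; alternating if it is either (an arc joining $i$ and $i+1$ is both). An alternating arc diagram is a noncrossing arc diagram all of whose arcs are alternating. For such a diagram $\Sigma$, $\pi(\Sigma)=(S'\cup S'',T'\cup T'')$ where $S'$ is the set of lower endpoints $i$ of right-even alternating arcs, $S''$ the set of $j-1$ for upper endpoints $j$ of left-even alternating arcs, $T'$ the set of $j-1$ for upper endpoints $j$ of right-even alternating arcs, and $T''$ the set of lower endpoints $i$ of left-even alternating arcs. *)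

theory Defs
  imports "HOL-Analysis.Analysis"
begin

text \<open>
  The combinatorial data of an arc: its lower and upper endpoint, and the set of those intermediate
  points that the arc leaves on its left, i.e. that it passes on their right-hand side. All other
  intermediate points are passed on their left-hand side.
\<close>

datatype arc = Arc (lower: nat) (upper: nat) (passed_right: "nat set")

definition intermediate :: "arc \<Rightarrow> nat set" where
  "intermediate a = {lower a<..<upper a}"

definition arcs :: "nat \<Rightarrow> arc set" where
  "arcs n = {a. 1 \<le> lower a \<and> lower a < upper a \<and> upper a \<le> n + 1
                 \<and> passed_right a \<subseteq> intermediate a}"

text \<open>
  In the plane \<open>real \<times> real\<close> the first coordinate increases to the right and the second one
  upwards; the vertical line is the second axis.
\<close>

definition pt :: "nat \<Rightarrow> real \<times> real" where
  "pt p = (0, real p)"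

definition passes_right :: "(real \<Rightarrow> real \<times> real) \<Rightarrow> nat \<Rightarrow> bool" where
  "passes_right \<gamma> p \<longleftrightarrow> (\<exists>x > 0. (x, real p) \<in> path_image \<gamma>)"

definition passes_left :: "(real \<Rightarrow> real \<times> real) \<Rightarrow> nat \<Rightarrow> bool" where
  "passes_left \<gamma> p \<longleftrightarrow> (\<exists>x < 0. (x, real p) \<in> path_image \<gamma>)"

text \<open>
  Since the height is strictly increasing, a curve meets each height at most once; hence a drawing
  of an arc meets no numbered point other than its endpoints, and cannot pass a point on both sides.
\<close>

definition draws :: "(real \<Rightarrow> real \<times> real) \<Rightarrow> arc \<Rightarrow> bool" where
  "draws \<gamma> a \<longleftrightarrow>
     path \<gamma> \<and> pathstart \<gamma> = pt (lower a) \<and> pathfinish \<gamma> = pt (upper a) \<and>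
     strict_mono_on {0..1} (\<lambda>t. snd (\<gamma> t)) \<and>
     (\<forall>p \<in> intermediate a. if p \<in> passed_right a then passes_right \<gamma> p else passes_left \<gamma> p)"

definition curve_interior :: "(real \<Rightarrow> real \<times> real) \<Rightarrow> (real \<times> real) set" where
  "curve_interior \<gamma> = \<gamma> ` {0<..<1}"

text \<open>
  Diagrams up to combinatorics: a set of combinatorial arcs is a diagram if all its arcs can be
  drawn simultaneously without crossings. One curve per combinatorial arc is enough, as
  combinatorially equal arcs share their endpoints.
\<close>

definition noncrossing_arc_diagram :: "nat \<Rightarrow> arc set \<Rightarrow> bool" where
  "noncrossing_arc_diagram n \<Sigma> \<longleftrightarrow>
     \<Sigma> \<subseteq> arcs n \<and>
     (\<exists>\<Gamma>. (\<forall>a\<in>\<Sigma>. draws (\<Gamma> a) a) \<and>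
          (\<forall>a\<in>\<Sigma>. \<forall>b\<in>\<Sigma>. a \<noteq> b \<longrightarrow> curve_interior (\<Gamma> a) \<inter> curve_interior (\<Gamma> b) = {})) \<and>
     (\<forall>a\<in>\<Sigma>. \<forall>b\<in>\<Sigma>. a \<noteq> b \<longrightarrow> upper a \<noteq> upper b \<and> lower a \<noteq> lower b)"

definition right_even_alternating :: "arc \<Rightarrow> bool" where
  "right_even_alternating a \<longleftrightarrow> (\<forall>p \<in> intermediate a. p \<in> passed_right a \<longleftrightarrow> even p)"

definition left_even_alternating :: "arc \<Rightarrow> bool" where
  "left_even_alternating a \<longleftrightarrow> (\<forall>p \<in> intermediate a. p \<in> passed_right a \<longleftrightarrow> odd p)"

definition alternating :: "arc \<Rightarrow> bool" where
  "alternating a \<longleftrightarrow> right_even_alternating a \<or> left_even_alternating a"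

definition alternating_arc_diagrams :: "nat \<Rightarrow> arc set set" where
  "alternating_arc_diagrams n = {\<Sigma>. noncrossing_arc_diagram n \<Sigma> \<and> (\<forall>a\<in>\<Sigma>. alternating a)}"

definition pi_map :: "arc set \<Rightarrow> nat set \<times> nat set" where
  "pi_map \<Sigma> =
     ({lower a |a. a \<in> \<Sigma> \<and> right_even_alternating a} \<union>
        {upper a - 1 |a. a \<in> \<Sigma> \<and> left_even_alternating a},
      {upper a - 1 |a. a \<in> \<Sigma> \<and> right_even_alternating a} \<union>
        {lower a |a. a \<in> \<Sigma> \<and> left_even_alternating a})"

end

(* Noncrossing is a pairwise condition on signs: if two arcs are on different sides of each other at
two heights of their common range, the curves cross by the intermediate value theorem. For arcs of
opposite kinds this forces the ranges not to overlap, since their relative position alternates with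
the parity of the height; for arcs of the same kind it is a parity condition on the ends of the
common range. Conversely explicit piecewise linear curves draw all compatible arcs at once.

For the bijection, regard (S, T) as the sets of first and last gaps of right-even arcs, with the
roles exchanged for left-even arcs. Let t be the least element of T, and let S contain an element
at most t (otherwise exchange the kinds). Then some right-even arc ends at t + 1, compatibility
determines its lower endpoint s among the elements of S up to t, and removing this arc leaves a
diagram for (S - {s}, T - {t}); any diagram for the latter can be extended by the arc. *)

theory Submission
  imports Defs
begin

section \<open>Combinatorial compatibility of alternating arcs\<close>

definition alt :: "bool \<Rightarrow> arc \<Rightarrow> bool" where
  "alt e a \<longleftrightarrow> (\<forall>p \<in> intermediate a. p \<in> passed_right a \<longleftrightarrow> even p = e)"

text \<open>Noncrossing, read off at the two ends of the common range. At \<open>lower b\<close> and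
  \<open>upper b\<close> the arc \<open>b\<close> is on the axis, so \<open>a\<close> must pass both
  points on the same side; if \<open>a\<close> ends first, then \<open>b\<close> must pass
  \<open>upper a\<close> on the side opposite to that on which \<open>a\<close> passes
  \<open>lower b\<close>. The parity clause treats only \<open>lower a < lower b\<close>, so
  diagrams ask for \<open>compatible\<close> on ordered pairs.\<close>

definition compatible :: "arc \<Rightarrow> arc \<Rightarrow> bool" where
  "compatible a b \<longleftrightarrow> lower a \<noteq> lower b \<and> upper a \<noteq> upper b \<and>
     (\<forall>e. alt e a \<longrightarrow> alt (\<not> e) b \<longrightarrow> upper a \<le> lower b \<or> upper b \<le> lower a) \<and>
     (\<forall>e. alt e a \<longrightarrow> alt e b \<longrightarrow> lower a < lower b \<longrightarrow> lower b < upper a \<longrightarrow>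
        (if upper b < upper a then even (lower b) = even (upper b)
         else even (lower b) \<noteq> even (upper a)))"

definition compatible_diagram :: "nat \<Rightarrow> arc set \<Rightarrow> bool" where
  "compatible_diagram n \<Sigma> \<longleftrightarrow>
     \<Sigma> \<subseteq> arcs n \<and> (\<forall>a\<in>\<Sigma>. \<exists>e. alt e a) \<and> (\<forall>a\<in>\<Sigma>. \<forall>b\<in>\<Sigma>. a \<noteq> b \<longrightarrow> compatible a b)"

lemma right_even_alternating_alt: "right_even_alternating = alt True"
  and left_even_alternating_alt: "left_even_alternating = alt False"
  by (simp_all add: fun_eq_iff right_even_alternating_def left_even_alternating_def alt_def)

lemma alternating_iff_alt: "alternating a \<longleftrightarrow> (\<exists>e. alt e a)"
  by (simp add: alternating_def right_even_alternating_alt left_even_alternating_alt ex_bool_eq)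

lemma alt_both:
  assumes "alt e a" "alt (\<not> e) a"
  shows "upper a \<le> Suc (lower a)"
proof (rule ccontr)
  assume "\<not> ?thesis"
  then have "Suc (lower a) \<in> intermediate a" by (simp add: intermediate_def)
  then show False using assms unfolding alt_def by blast
qed

section \<open>From curves to compatibility\<close>

text \<open>The sign of the abscissa at height \<open>p\<close>; the default 0 is its true sign at
  the two endpoints.\<close>

definition side :: "arc \<Rightarrow> nat \<Rightarrow> real" where
  "side a p = (if p \<in> intermediate a then if p \<in> passed_right a then 1 else -1 else 0)"

text \<open>The height is a continuous, strictly increasing function of the parameter, so it can be
  inverted and the curve becomes the graph of an abscissa \<open>X\<close> over the height.\<close>

lemma draws_graph:
  assumes "draws \<gamma> a" "lower a < upper a"
  obtains X where "continuous_on {real (lower a)..real (upper a)} X"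
    and "\<And>y. real (lower a) < y \<Longrightarrow> y < real (upper a) \<Longrightarrow> (X y, y) \<in> curve_interior \<gamma>"
    and "\<And>p. lower a \<le> p \<Longrightarrow> p \<le> upper a \<Longrightarrow> sgn (X (real p)) = side a p"
proof -
  define h where "h t = snd (\<gamma> t)" for t
  have cg: "continuous_on {0..1} \<gamma>" and g0: "\<gamma> 0 = (0, real (lower a))"
    and g1: "\<gamma> 1 = (0, real (upper a))" and sm: "strict_mono_on {0..1} h"
    using assms unfolding draws_def path_def pathstart_def pathfinish_def pt_def h_def by auto
  have ch: "continuous_on {0..1} h"
    unfolding h_def by (intro continuous_intros cg)
  have inj: "inj_on h {0..1}"
    using sm by (rule strict_mono_on_imp_inj_on)
  have im: "h ` {0..1} = {real (lower a)..real (upper a)}"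
  proof
    show "h ` {0..1} \<subseteq> {real (lower a)..real (upper a)}"
    proof
      fix y assume "y \<in> h ` {0..1}"
      then obtain t where t: "t \<in> {0..1}" "y = h t" by auto
      have "h 0 \<le> h t" "h t \<le> h 1"
        using t strict_mono_on_leD[OF sm] by auto
      then show "y \<in> {real (lower a)..real (upper a)}"
        using t g0 g1 by (simp add: h_def)
    qed
    show "{real (lower a)..real (upper a)} \<subseteq> h ` {0..1}"
    proof
      fix y assume "y \<in> {real (lower a)..real (upper a)}"
      then have "\<exists>x\<ge>0. x \<le> 1 \<and> h x = y"
        using g0 g1 ch by (intro IVT') (auto simp: h_def)
      then show "y \<in> h ` {0..1}" by auto
    qed
  qed
  define g where "g = the_inv_into {0..1} h"
  have gh: "g (h t) = t" if "t \<in> {0..1}" for t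
    unfolding g_def using inj that by (rule the_inv_into_f_f)
  have g01: "g y \<in> {0..1}" and hg: "h (g y) = y" if "y \<in> {real (lower a)..real (upper a)}" for y
    using that gh im by (metis imageE)+
  have cont: "continuous_on {real (lower a)..real (upper a)} g"
    using continuous_on_inv[OF ch compact_Icc] gh im by metis
  define X where "X y = fst (\<gamma> (g y))" for y
  have gl: "g (real (lower a)) = 0" and gu: "g (real (upper a)) = 1"
    using gh[of 0] gh[of 1] g0 g1 by (auto simp: h_def)
  have X: "\<gamma> (g y) = (X y, y)" if "y \<in> {real (lower a)..real (upper a)}" for y
    using hg[OF that] by (simp add: X_def h_def prod_eq_iff)
  show thesis
  proof
    show "continuous_on {real (lower a)..real (upper a)} X"
      unfolding X_def
      by (intro continuous_intros continuous_on_compose2[OF cg cont]) (use g01 in auto)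
    show "(X y, y) \<in> curve_interior \<gamma>" if "real (lower a) < y" "y < real (upper a)" for y
    proof -
      have y: "y \<in> {real (lower a)..real (upper a)}" using that by auto
      have "g y \<noteq> 0" "g y \<noteq> 1"
        using hg[OF y] that g0 g1 by (auto simp: h_def)
      with g01[OF y] have "g y \<in> {0<..<1}" by auto
      then show ?thesis using X[OF y] unfolding curve_interior_def by (metis imageI)
    qed
    show "sgn (X (real p)) = side a p" if p: "lower a \<le> p" "p \<le> upper a" for p
    proof (cases "p \<in> intermediate a")
      case True
      have *: "x = X (real p)" if "(x, real p) \<in> path_image \<gamma>" for x
      proof -
        from that obtain t where t: "(x, real p) = \<gamma> t" "t \<in> {0..1}"
          unfolding path_image_def by (rule imageE)
        then have "h t = real p" by (simp add: h_def flip: t(1))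
        then have "t = g (real p)" using gh[OF t(2)] by simp
        then have "X (real p) = fst (\<gamma> t)" by (simp add: X_def)
        then show ?thesis by (simp flip: t(1))
      qed
      have side: "if p \<in> passed_right a then passes_right \<gamma> p else passes_left \<gamma> p"
        using assms(1) True unfolding draws_def by blast
      show ?thesis
      proof (cases "p \<in> passed_right a")
        case right: True
        then obtain x where "x > 0" "(x, real p) \<in> path_image \<gamma>"
          using side unfolding passes_right_def by auto
        then show ?thesis using *[of x] True right by (simp add: side_def)
      next
        case left: False
        then obtain x where "x < 0" "(x, real p) \<in> path_image \<gamma>"
          using side unfolding passes_left_def by auto
        then show ?thesis using *[of x] True left by (simp add: side_def)
      qed
    next
      case False
      then have "p = lower a \<or> p = upper a" using p by (auto simp: intermediate_def)
      then show ?thesis using False gl gu g0 g1 by (auto simp: side_def X_def)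
    qed
  qed
qed

text \<open>The difference of the two abscissae changes sign between the heights \<open>p\<close>
  and \<open>q\<close>, so it vanishes at some height in between, where the curves meet.\<close>

lemma sides_do_not_swap:
  assumes "draws \<gamma> a" "draws \<delta> b" "lower a < upper a" "lower b < upper b"
    and disj: "curve_interior \<gamma> \<inter> curve_interior \<delta> = {}"
    and p: "lower a \<le> p" "lower b \<le> p" "p \<le> upper a" "p \<le> upper b"
    and q: "lower a \<le> q" "lower b \<le> q" "q \<le> upper a" "q \<le> upper b"
    and sp: "side a p < side b p" and sq: "side b q < side a q"
  shows False
proof -
  obtain X where X: "continuous_on {real (lower a)..real (upper a)} X"
    "\<And>y. real (lower a) < y \<Longrightarrow> y < real (upper a) \<Longrightarrow> (X y, y) \<in> curve_interior \<gamma>"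
    "\<And>p. lower a \<le> p \<Longrightarrow> p \<le> upper a \<Longrightarrow> sgn (X (real p)) = side a p"
    using draws_graph[OF assms(1,3)] by metis
  obtain Y where Y: "continuous_on {real (lower b)..real (upper b)} Y"
    "\<And>y. real (lower b) < y \<Longrightarrow> y < real (upper b) \<Longrightarrow> (Y y, y) \<in> curve_interior \<delta>"
    "\<And>p. lower b \<le> p \<Longrightarrow> p \<le> upper b \<Longrightarrow> sgn (Y (real p)) = side b p"
    using draws_graph[OF assms(2,4)] by metis
  have sgn_less: "x < y" if "sgn x < sgn y" for x y :: real
    using that by (auto simp: sgn_if split: if_splits)
  define D where "D y = Y y - X y" for y
  have Dp: "D p > 0" using sgn_less[of "X p" "Y p"] X(3) Y(3) p sp by (simp add: D_def)
  have Dq: "D q < 0" using sgn_less[of "Y q" "X q"] X(3) Y(3) q sq by (simp add: D_def)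
  define lo hi where "lo = real (min p q)" and "hi = real (max p q)"
  have sub: "{lo..hi} \<subseteq> {real (lower a)..real (upper a)}"
            "{lo..hi} \<subseteq> {real (lower b)..real (upper b)}"
    using p q by (auto simp: lo_def hi_def)
  have cont: "continuous_on {lo..hi} D"
    unfolding D_def
    by (intro continuous_intros continuous_on_subset[OF X(1) sub(1)]
        continuous_on_subset[OF Y(1) sub(2)])
  have "\<exists>y\<ge>lo. y \<le> hi \<and> D y = 0"
  proof (cases "p \<le> q")
    case True
    then show ?thesis using Dp Dq cont by (intro IVT2') (auto simp: lo_def hi_def)
  next
    case False
    then show ?thesis using Dp Dq cont by (intro IVT') (auto simp: lo_def hi_def)
  qed
  then obtain y where y: "lo \<le> y" "y \<le> hi" "D y = 0" by auto
  \<comment> \<open>As \<open>D\<close> does not vanish at \<open>p\<close> and \<open>q\<close>,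
    the meeting point is interior to both curves even if \<open>p\<close> or \<open>q\<close> is an
    endpoint.\<close>
  then have "y \<noteq> p" "y \<noteq> q" using Dp Dq by auto
  then have "lo < y" "y < hi" using y by (auto simp: lo_def hi_def min_def max_def split: if_splits)
  then have "real (lower a) < y" "y < real (upper a)" "real (lower b) < y" "y < real (upper b)"
    using p q by (auto simp: lo_def hi_def)
  then have "(X y, y) \<in> curve_interior \<gamma>" "(Y y, y) \<in> curve_interior \<delta>"
    using X(2) Y(2) by auto
  then show False using disj y(3) by (auto simp: D_def)
qed

lemma side_alt:
  "alt e a \<Longrightarrow> lower a < p \<Longrightarrow> p < upper a \<Longrightarrow> side a p = (if even p = e then 1 else -1)"
  by (auto simp: alt_def side_def intermediate_def)

lemma side_ends [simp]: "side a (lower a) = 0" "side a (upper a) = 0"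
  by (auto simp: side_def intermediate_def)

lemma compatible_of_sides:
  assumes no: "\<And>p q. lower a \<le> p \<Longrightarrow> lower b \<le> p \<Longrightarrow> p \<le> upper a \<Longrightarrow> p \<le> upper b \<Longrightarrow>
      lower a \<le> q \<Longrightarrow> lower b \<le> q \<Longrightarrow> q \<le> upper a \<Longrightarrow> q \<le> upper b \<Longrightarrow>
      side a p < side b p \<Longrightarrow> side b q < side a q \<Longrightarrow> False"
    and ab: "lower a < upper a" "lower b < upper b" "lower a \<noteq> lower b" "upper a \<noteq> upper b"
  shows "compatible a b"
  unfolding compatible_def
proof (intro conjI allI impI)
  fix e assume e: "alt e a" "alt (\<not> e) b"
  show "upper a \<le> lower b \<or> upper b \<le> lower a"
  proof (rule ccontr)
    assume n: "\<not> ?thesis"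
    \<comment> \<open>The heights \<open>p\<close> and \<open>Suc p\<close> both lie in the common
      range and have different parities, which yields the forbidden swap.\<close>
    define p where "p = max (lower a) (lower b)"
    \<comment> \<open>The order at height \<open>q\<close> depends only on the parity of
      \<open>q\<close>. At an endpoint of one arc the other is off the axis, since the ranges
      overlap and no lower or upper endpoint is shared.\<close>
    have *: "if even q = e then side b q < side a q else side a q < side b q"
      if "lower a \<le> q" "lower b \<le> q" "q \<le> upper a" "q \<le> upper b" for q
    proof -
      have "lower a = q \<or> lower a < q \<and> q < upper a \<or> upper a = q"
           "lower b = q \<or> lower b < q \<and> q < upper b \<or> upper b = q"
        using that by auto
      then show ?thesis
        using side_alt[OF e(1), of q] side_alt[OF e(2), of q] n ab
          side_ends[of a] side_ends[of b]
        by (elim disjE conjE) (auto split: if_splits)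
    qed
    have p: "lower a \<le> p" "lower b \<le> p" "p \<le> upper a" "p \<le> upper b"
      "lower a \<le> Suc p" "lower b \<le> Suc p" "Suc p \<le> upper a" "Suc p \<le> upper b"
      using n ab by (auto simp: p_def)
    have "even (Suc p) \<longleftrightarrow> odd p" by simp
    then show False
      using *[OF p(1-4)] *[OF p(5-8)] no[OF p] no[OF p(5-8) p(1-4)]
      by (metis (full_types))
  qed
next
  fix e assume e: "alt e a" "alt e b" and l: "lower a < lower b" "lower b < upper a"
  note sa = side_alt[OF e(1)] and sb = side_alt[OF e(2)]
  show "if upper b < upper a then even (lower b) = even (upper b)
         else even (lower b) \<noteq> even (upper a)"
  \<comment> \<open>Only the two ends of the common range are compared; at each of them one of the
    two sides is 0.\<close>
  proof (cases "upper b < upper a")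
    case True
    then show ?thesis
      using no[of "lower b" "upper b"] no[of "upper b" "lower b"] sa[of "lower b"] sa[of "upper b"]
        l ab
      by (auto split: if_splits)
  next
    case False
    then show ?thesis
      using no[of "lower b" "upper a"] no[of "upper a" "lower b"] sa[of "lower b"] sb[of "upper a"]
        l ab
      by (auto split: if_splits)
  qed
qed (use ab in auto)

section \<open>From compatibility to curves\<close>

text \<open>A sum of hat functions: the piecewise linear function with value \<open>v p\<close> at
  \<open>p \<in> A\<close> and 0 at all other integers.\<close>

definition interpolation :: "nat set \<Rightarrow> (nat \<Rightarrow> real) \<Rightarrow> real \<Rightarrow> real" where
  "interpolation A v y = (\<Sum>p\<in>A. v p * max 0 (1 - \<bar>y - real p\<bar>))"

lemma interpolation_between:
  assumes "finite A" "real k \<le> y" "y \<le> real k + 1"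
  shows "interpolation A v y =
    (real k + 1 - y) * (if k \<in> A then v k else 0) + (y - real k) * (if Suc k \<in> A then v (Suc k) else 0)"
proof -
  have "v p * max 0 (1 - \<bar>y - real p\<bar>) =
      (if p = k then (real k + 1 - y) * v k else 0) +
      (if p = Suc k then (y - real k) * v (Suc k) else 0)" for p
  proof -
    consider "p = k" | "p = Suc k" | "p < k" | "p > Suc k" by linarith
    then show ?thesis
    proof cases
      case 3
      then have "real p + 1 \<le> real k" by linarith
      then show ?thesis using 3 assms by simp
    next
      case 4
      then have "real p \<ge> real k + 2" by linarith
      then show ?thesis using 4 assms by simp
    qed (use assms in auto)
  qed
  then show ?thesis
    using assms(1) unfolding interpolation_def by (simp add: sum.distrib)
qed

lemma interpolation_nat:
  "finite A \<Longrightarrow> interpolation A v (real k) = (if k \<in> A then v k else 0)"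
  using interpolation_between[of A k "real k" v] by simp

text \<open>
  Where arcs of the same kind overlap, the left-to-right order is decided at the higher of their
  lower endpoints: the newcomer is extremal, on the side given by the parity of that endpoint.
  The signed lower endpoint \<open>\<plusminus> lower a\<close> induces this order, and the shift by
  \<open>\<plusminus> (n + 2)\<close> moves all curves to the prescribed side.
\<close>

definition abscissa :: "nat \<Rightarrow> arc \<Rightarrow> nat \<Rightarrow> real" where
  "abscissa n a p = (if alt True a then 1 else -1) *
     ((-1) ^ p * real (n + 2) - (-1) ^ lower a * real (lower a))"

definition curve :: "nat \<Rightarrow> arc \<Rightarrow> real \<Rightarrow> real \<times> real" where
  "curve n a t = (let y = real (lower a) + t * (real (upper a) - real (lower a))
     in (interpolation (intermediate a) (abscissa n a) y, y))"

lemma finite_intermediate [simp]: "finite (intermediate a)"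
  by (simp add: intermediate_def)

lemma arcsD:
  assumes "a \<in> arcs n"
  shows "1 \<le> lower a" "lower a < upper a" "upper a \<le> n + 1" "passed_right a \<subseteq> intermediate a"
  using assms by (auto simp: arcs_def)

lemma draws_curve:
  assumes a: "a \<in> arcs n" and "alt e a"
  shows "draws (curve n a) a"
  unfolding draws_def
proof (intro conjI ballI)
  note A = arcsD[OF a]
  show "path (curve n a)"
    unfolding path_def curve_def Let_def interpolation_def
    by (intro continuous_intros)
  show "pathstart (curve n a) = pt (lower a)" "pathfinish (curve n a) = pt (upper a)"
    by (auto simp: pathstart_def pathfinish_def curve_def Let_def pt_def interpolation_nat
        intermediate_def)
  show "strict_mono_on {0..1} (\<lambda>t. snd (curve n a t))"
    using A by (auto simp: strict_mono_on_def curve_def Let_def)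
  fix p assume p: "p \<in> intermediate a"
  then have lp: "lower a < p" "p < upper a" by (auto simp: intermediate_def)
  \<comment> \<open>The parameter at which the affine height function reaches
    \<open>p\<close>.\<close>
  define t where "t = (real p - real (lower a)) / (real (upper a) - real (lower a))"
  have t: "t \<in> {0..1}" "real (lower a) + t * (real (upper a) - real (lower a)) = real p"
    using lp by (auto simp: t_def field_simps)
  have "curve n a t = (abscissa n a p, real p)"
    using t p by (simp add: curve_def Let_def interpolation_nat)
  then have im: "(abscissa n a p, real p) \<in> path_image (curve n a)"
    using t unfolding path_image_def by (metis imageI)
  have "alt True a \<or> (alt False a \<and> \<not> alt True a)" using assms by (cases e) auto
  then have "(p \<in> passed_right a \<longleftrightarrow> even p) \<and> alt True a \<or>
      (p \<in> passed_right a \<longleftrightarrow> odd p) \<and> \<not> alt True a"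
    using p by (auto simp: alt_def)
  \<comment> \<open>Since \<open>lower a \<le> n\<close>, the shift \<open>n + 2\<close> outweighs
    the term \<open>lower a\<close>, so the sign is decided by the parity of \<open>p\<close> and
    the kind.\<close>
  then have "if p \<in> passed_right a then abscissa n a p > 0 else abscissa n a p < 0"
    using A lp by (cases "even p"; cases "even (lower a)") (auto simp: abscissa_def)
  with im show "if p \<in> passed_right a then passes_right (curve n a) p else passes_left (curve n a) p"
    by (auto simp: passes_right_def passes_left_def split: if_splits)
qed

text \<open>At every integer height of the common range the difference of the abscissae has the same
  sign \<open>s\<close>, and linear interpolation keeps it.\<close>

lemma interpolations_differ:
  assumes a: "a \<in> arcs n" and b: "b \<in> arcs n" and e: "alt e a" "alt e b"
    and same: "alt True a = alt True b"
    and c: "compatible a b" and less: "lower a < lower b"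
    and y: "real (lower b) < y" "y < real (upper a)" "y < real (upper b)"
  shows "interpolation (intermediate a) (abscissa n a) y \<noteq>
         interpolation (intermediate b) (abscissa n b) y"
proof -
  note A = arcsD[OF a] and B = arcsD[OF b]
  \<comment> \<open>The sign of the difference at \<open>lower b\<close>, where \<open>b\<close> is
    on the axis. Strictly inside both arcs the shifts cancel and \<open>lower a < lower b\<close>
    decides; at the upper end compatibility does.\<close>
  define s :: real where "s = (if alt True a then 1 else -1) * - ((-1) ^ lower b)"
  define w where "w c q = (if q \<in> intermediate c then abscissa n c q else 0)" for c q
  have lu: "lower b < upper a" using y by linarith
  have par: "if upper b < upper a then even (lower b) = even (upper b)
         else even (lower b) \<noteq> even (upper a)"
    using c e less lu by (auto simp: compatible_def)
  have ne: "upper a \<noteq> upper b" using c by (auto simp: compatible_def)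
  have pos: "s * (w b q - w a q) > 0" if q: "lower b \<le> q" "q \<le> upper a" "q \<le> upper b" for q
  proof -
    consider "q = lower b" | "lower b < q" "q < upper a" "q < upper b"
      | "q = upper b" "q < upper a" | "q = upper a" "q < upper b"
      using q ne by linarith
    then show ?thesis
    proof cases
      case 1
      then show ?thesis using A B less lu
        by (cases "even (lower a)"; cases "even (lower b)")
           (auto simp: w_def s_def abscissa_def intermediate_def)
    next
      case 2
      then show ?thesis using A B less same
        by (cases "even (lower a)"; cases "even (lower b)")
           (auto simp: w_def s_def abscissa_def intermediate_def)
    next
      case 3
      then show ?thesis using A B less lu par
        by (cases "even (lower a)"; cases "even (lower b)")
           (auto simp: w_def s_def abscissa_def intermediate_def)
    next
      case 4
      then show ?thesis using A B less lu par same
        by (cases "even (lower a)"; cases "even (lower b)")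
           (auto simp: w_def s_def abscissa_def intermediate_def)
    qed
  qed
  \<comment> \<open>With the floor, the weight of \<open>k\<close> is strictly positive, while that
    of \<open>Suc k\<close> may be 0; one strict inequality suffices.\<close>
  define k where "k = nat \<lfloor>y\<rfloor>"
  have k: "real k \<le> y" "y < real k + 1" using y by (auto simp: k_def)
  have kb: "lower b \<le> k" "Suc k \<le> upper a" "Suc k \<le> upper b" using k y by linarith+
  have I: "interpolation (intermediate c) (abscissa n c) y =
      (real k + 1 - y) * w c k + (y - real k) * w c (Suc k)" for c
    using k by (simp add: interpolation_between w_def)
  have "(real k + 1 - y) * (s * (w b k - w a k)) > 0"
    using k pos[of k] kb by simp
  moreover have "(y - real k) * (s * (w b (Suc k) - w a (Suc k))) \<ge> 0"
    using k pos[of "Suc k"] kb by simp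
  ultimately have "s * (interpolation (intermediate b) (abscissa n b) y -
      interpolation (intermediate a) (abscissa n a) y) > 0"
    unfolding I by (simp add: algebra_simps)
  then show ?thesis by auto
qed

lemma curves_disjoint:
  assumes a: "a \<in> arcs n" and b: "b \<in> arcs n" and e: "alt e a" "alt f b"
    and c: "compatible a b" "compatible b a"
  shows "curve_interior (curve n a) \<inter> curve_interior (curve n b) = {}"
proof (rule ccontr)
  assume "\<not> ?thesis"
  then obtain t u where tu: "t \<in> {0<..<1}" "u \<in> {0<..<1}" "curve n a t = curve n b u"
    unfolding curve_interior_def by fastforce
  have bounds: "l < l + t * (u - l)" "l + t * (u - l) < u"
    if "t \<in> {0<..<1}" "l < u" for t l u :: real
  proof -
    show "l < l + t * (u - l)" using that by simp
    have "(1 - t) * (u - l) > 0" using that by simp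
    then show "l + t * (u - l) < u" by (simp add: algebra_simps)
  qed
  define y where "y = real (lower a) + t * (real (upper a) - real (lower a))"
  have y': "y = real (lower b) + u * (real (upper b) - real (lower b))"
    and eq: "interpolation (intermediate a) (abscissa n a) y =
      interpolation (intermediate b) (abscissa n b) y"
    using tu(3) by (auto simp: curve_def Let_def y_def)
  have y: "real (lower a) < y" "y < real (upper a)" "real (lower b) < y" "y < real (upper b)"
    using bounds[OF tu(1), of "real (lower a)" "real (upper a)"]
      bounds[OF tu(2), of "real (lower b)" "real (upper b)"]
      arcsD[OF a] arcsD[OF b] unfolding y_def[symmetric] y'[symmetric] by auto
  then have ov: "\<not> (upper a \<le> lower b \<or> upper b \<le> lower a)" by linarith
  then have no: "\<not> (alt g a \<and> alt (\<not> g) b)" for g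
    using c(1) unfolding compatible_def by blast
  \<comment> \<open>Overlapping arcs are of the same kind. In particular an arc of both kinds
    overlaps no compatible alternating arc, so the test \<open>alt True\<close> inside
    \<open>abscissa\<close> also agrees on \<open>a\<close> and \<open>b\<close>.\<close>
  have "e = f" using no[of e] e by (cases e; cases f) simp_all
  moreover have same: "alt True a = alt True b"
    using no[of True] no[of False] e \<open>e = f\<close> by (cases f) simp_all
  ultimately have e': "alt f a" using e by simp
  \<comment> \<open>Whichever arc starts lower plays the first role in
    \<open>interpolations_differ\<close>.\<close>
  then show False
    using interpolations_differ[OF a b e' e(2) same c(1) _ y(3,2,4)]
      interpolations_differ[OF b a e(2) e' same[symmetric] c(2) _ y(1,4,2)] eq c(1)
    unfolding compatible_def by (metis linorder_neqE_nat)
qed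

section \<open>Diagrams as sets of pairwise compatible arcs\<close>

lemma alternating_arc_diagrams_iff:
  "\<Sigma> \<in> alternating_arc_diagrams n \<longleftrightarrow> compatible_diagram n \<Sigma>"
proof
  assume "\<Sigma> \<in> alternating_arc_diagrams n"
  then have nc: "noncrossing_arc_diagram n \<Sigma>" and S2: "\<forall>a\<in>\<Sigma>. \<exists>e. alt e a"
    by (simp_all add: alternating_arc_diagrams_def alternating_iff_alt)
  from nc have S1: "\<Sigma> \<subseteq> arcs n"
    and ends: "\<forall>a\<in>\<Sigma>. \<forall>b\<in>\<Sigma>. a \<noteq> b \<longrightarrow> upper a \<noteq> upper b \<and> lower a \<noteq> lower b"
    by (simp_all add: noncrossing_arc_diagram_def)
  from nc obtain \<Gamma> where d: "\<forall>a\<in>\<Sigma>. draws (\<Gamma> a) a"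
    and dis: "\<forall>a\<in>\<Sigma>. \<forall>b\<in>\<Sigma>. a \<noteq> b \<longrightarrow> curve_interior (\<Gamma> a) \<inter> curve_interior (\<Gamma> b) = {}"
    unfolding noncrossing_arc_diagram_def by (elim conjE exE)
  have "compatible a b" if ab: "a \<in> \<Sigma>" "b \<in> \<Sigma>" "a \<noteq> b" for a b
  proof -
    have lt: "lower a < upper a" "lower b < upper b"
      using ab(1,2) S1 arcsD(2)[of _ n] by (meson subsetD)+
    have "lower a \<noteq> lower b" "upper a \<noteq> upper b" using ends ab by simp_all
    then show ?thesis
      using sides_do_not_swap[OF d[rule_format, OF ab(1)] d[rule_format, OF ab(2)] lt
          dis[rule_format, OF ab]]
      by (intro compatible_of_sides lt)
  qed
  then show "compatible_diagram n \<Sigma>"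
    using S1 S2 unfolding compatible_diagram_def by blast
next
  assume D: "compatible_diagram n \<Sigma>"
  show "\<Sigma> \<in> alternating_arc_diagrams n"
    unfolding alternating_arc_diagrams_def noncrossing_arc_diagram_def alternating_iff_alt
      mem_Collect_eq
  \<comment> \<open>The drawings \<open>curve n\<close> do not depend on \<open>\<Sigma>\<close>, so
    disjointness is a matter of pairs.\<close>
  proof (intro conjI exI[of _ "curve n"] ballI impI)
    fix a assume a: "a \<in> \<Sigma>"
    then have A: "a \<in> arcs n" using D by (auto simp: compatible_diagram_def)
    show ea: "\<exists>e. alt e a"
      using D a by (simp add: compatible_diagram_def)
    then show "draws (curve n a) a"
      using draws_curve[OF A] by auto
    fix b assume b: "b \<in> \<Sigma>" "a \<noteq> b"
    then have B: "b \<in> arcs n" using D by (auto simp: compatible_diagram_def)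
    have "\<exists>e. alt e b" and c: "compatible a b" "compatible b a"
      using D a b by (simp_all add: compatible_diagram_def)
    then show "curve_interior (curve n a) \<inter> curve_interior (curve n b) = {}"
      using ea curves_disjoint[OF A B] by auto
    show "upper a \<noteq> upper b" "lower a \<noteq> lower b"
      using c by (simp_all add: compatible_def)
  qed (use D in \<open>simp add: compatible_diagram_def\<close>)
qed

section \<open>The combinatorial bijection\<close>

text \<open>\<open>val True\<close> and \<open>val False\<close> are the contributions of an arc to
  the two components of \<open>pi_map\<close>. An arc of both kinds joins neighbouring points, so
  \<open>lower a = upper a - 1\<close> and both branches agree.\<close>

definition val :: "bool \<Rightarrow> arc \<Rightarrow> nat" where
  "val e a = (if alt e a then lower a else upper a - 1)"

lemma alt_both_upper: "a \<in> arcs n \<Longrightarrow> alt e a \<Longrightarrow> alt (\<not> e) a \<Longrightarrow> upper a = Suc (lower a)"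
  using alt_both[of e a] arcsD(2)[of a n] by linarith

lemma val_alt:
  assumes "a \<in> arcs n" "alt e a"
  shows "val e a = lower a" "val (\<not> e) a = upper a - 1"
  using assms alt_both_upper[OF assms] by (auto simp: val_def)

lemma val_range: "a \<in> arcs n \<Longrightarrow> val e a \<in> {1..n}"
  using arcsD[of a n] by (auto simp: val_def)

lemma pi_map_eq:
  assumes "compatible_diagram n \<Sigma>"
  shows "pi_map \<Sigma> = (val True ` \<Sigma>, val False ` \<Sigma>)"
proof -
  have *: "val e ` \<Sigma> = {lower a |a. a \<in> \<Sigma> \<and> alt e a} \<union> {upper a - 1 |a. a \<in> \<Sigma> \<and> alt (\<not> e) a}"
    for e
  proof -
    have "val e a = lower a" "val (\<not> e) a = upper a - 1" if "a \<in> \<Sigma>" "alt e a" for a e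
      using val_alt[of a n e] that assms by (auto simp: compatible_diagram_def)
    from this[of _ e] this[of _ "\<not> e"]
    have l: "a \<in> \<Sigma> \<Longrightarrow> alt e a \<Longrightarrow> val e a = lower a"
      and u: "a \<in> \<Sigma> \<Longrightarrow> alt (\<not> e) a \<Longrightarrow> val e a = upper a - 1" for a
      by simp_all
    have alts: "alt e a \<or> alt (\<not> e) a" if "a \<in> \<Sigma>" for a
    proof -
      obtain f where "alt f a" using assms \<open>a \<in> \<Sigma>\<close> by (auto simp: compatible_diagram_def)
      then show ?thesis by (cases "f = e") auto
    qed
    have "val e ` \<Sigma> = val e ` {a \<in> \<Sigma>. alt e a} \<union> val e ` {a \<in> \<Sigma>. alt (\<not> e) a}"
      using alts by blast
    also have "val e ` {a \<in> \<Sigma>. alt e a} = lower ` {a \<in> \<Sigma>. alt e a}"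
      using l by (intro image_cong) auto
    also have "val e ` {a \<in> \<Sigma>. alt (\<not> e) a} = (\<lambda>a. upper a - 1) ` {a \<in> \<Sigma>. alt (\<not> e) a}"
      using u by (intro image_cong) auto
    finally show ?thesis by blast
  qed
  show ?thesis
    unfolding pi_map_def right_even_alternating_alt left_even_alternating_alt
    using *[of True] *[of False] by auto
qed

text \<open>Arcs of both kinds fall under the first case, so the second may use
  \<open>\<not> alt e a\<close>.\<close>

lemma alt_cases:
  assumes "compatible_diagram n \<Sigma>" "a \<in> \<Sigma>"
  obtains "alt e a" "val e a = lower a" "val (\<not> e) a = upper a - 1"
  | "\<not> alt e a" "alt (\<not> e) a" "val e a = upper a - 1" "val (\<not> e) a = lower a"
proof -
  have A: "a \<in> arcs n" using assms by (auto simp: compatible_diagram_def)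
  obtain f where f: "alt f a" using assms by (auto simp: compatible_diagram_def)
  show thesis
  proof (cases "alt e a")
    case True
    then show ?thesis using that(1) val_alt[OF A] by blast
  next
    case False
    then have "alt (\<not> e) a" using f by (cases "f = e") auto
    then show ?thesis using that(2) val_alt[OF A, of "\<not> e"] False by simp
  qed
qed

lemma opposite_disjoint:
  "compatible a b \<Longrightarrow> alt e a \<Longrightarrow> alt (\<not> e) b \<Longrightarrow> upper a \<le> lower b \<or> upper b \<le> lower a"
  by (simp add: compatible_def)

lemma compatible_upper: "compatible a b \<Longrightarrow> upper a \<noteq> upper b"
  by (simp add: compatible_def)

lemma compatible_parity:
  assumes "compatible a b" "alt e a" "alt e b" "lower a < lower b" "lower b < upper a"
  shows "upper b < upper a \<Longrightarrow> even (lower b) = even (upper b)"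
    and "upper a < upper b \<Longrightarrow> even (lower b) \<noteq> even (upper a)"
  using assms by (auto simp: compatible_def split: if_splits)

text \<open>For arcs of the same kind, equal values mean a shared lower or upper endpoint; for
  opposite kinds, the last gap of one is the first gap of the other, so the ranges overlap.\<close>

lemma inj_on_val:
  assumes D: "compatible_diagram n \<Sigma>"
  shows "inj_on (val e) \<Sigma>"
proof (rule inj_onI, rule ccontr)
  fix a b assume ab: "a \<in> \<Sigma>" "b \<in> \<Sigma>" "val e a = val e b" "a \<noteq> b"
  then have c: "compatible a b" "compatible b a" and "a \<in> arcs n" "b \<in> arcs n"
    using D by (auto simp: compatible_diagram_def)
  then have A: "1 \<le> lower a" "lower a < upper a" and B: "1 \<le> lower b" "lower b < upper b"
    using arcsD by blast+
  have ne: "lower a \<noteq> lower b" "upper a \<noteq> upper b" using c by (auto simp: compatible_def)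
  show False
    using D ab(1)
  proof (cases rule: alt_cases[where e = e])
    case a: 1
    show False using D ab(2)
    proof (cases rule: alt_cases[where e = e])
      case 1
      then show False using a ab(3) ne by simp
    next
      case 2
      then show False using a ab(3) A B opposite_disjoint[OF c(1), of e] by auto
    qed
  next
    case a: 2
    show False using D ab(2)
    proof (cases rule: alt_cases[where e = e])
      case 1
      then show False using a ab(3) A B opposite_disjoint[OF c(2), of e] by auto
    next
      case 2
      then show False using a ab(3) ne A B by auto
    qed
  qed
qed

section \<open>The arc that ends first\<close>

text \<open>
  Arcs of one kind behave as a deque: the first arc of kind \<open>e\<close> to end,
  at \<open>t + 1\<close> say, must be the outermost of those begun so far, on the side where arcs
  starting at points of the parity of \<open>t + 1\<close> enter.
\<close>

definition matching_start :: "nat set \<Rightarrow> nat \<Rightarrow> nat \<Rightarrow> bool" where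
  "matching_start A t s \<longleftrightarrow> s \<in> A \<and> s \<le> t \<and>
     (\<forall>r\<in>A. r \<le> t \<longrightarrow> (r < s \<longrightarrow> even s \<noteq> even t) \<and> (s < r \<longrightarrow> even r = even t))"

lemma matching_start_unique:
  assumes r: "matching_start A t r" and s: "matching_start A t s"
  shows "r = s"
proof -
  have "\<not> x < y" if x: "matching_start A t x" and y: "matching_start A t y" for x y
  proof
    assume "x < y"
    moreover have "x \<in> A" "x \<le> t" "y \<in> A" "y \<le> t"
      using x y by (simp_all only: matching_start_def)
    ultimately have "even y = even t" "even y \<noteq> even t"
      using x y unfolding matching_start_def by blast+
    then show False by simp
  qed
  from this[OF r s] this[OF s r] show ?thesis by simp
qed

text \<open>The greatest element up to \<open>t\<close> of parity other than that of
  \<open>t\<close> qualifies if there is one; otherwise the least element does.\<close>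

lemma matching_start_exists:
  assumes "m \<in> A" "m \<le> t"
  shows "\<exists>s. matching_start A t s"
proof (cases "\<exists>r\<in>A. r \<le> t \<and> even r \<noteq> even t")
  case True
  define P where "P r \<longleftrightarrow> r \<in> A \<and> r \<le> t \<and> even r \<noteq> even t" for r
  obtain r where "P r" using True by (auto simp: P_def)
  moreover have "\<And>r. P r \<Longrightarrow> r \<le> t" by (simp add: P_def)
  ultimately have "P (Greatest P)" "\<And>r. P r \<Longrightarrow> r \<le> Greatest P"
    using GreatestI_nat Greatest_le_nat by metis+
  then have "matching_start A t (Greatest P)"
    unfolding matching_start_def P_def by (meson not_le)
  then show ?thesis ..
next
  case False
  define P where "P r \<longleftrightarrow> r \<in> A \<and> r \<le> t" for r
  have "P m" using assms by (simp add: P_def)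
  then have "P (Least P)" "\<And>r. P r \<Longrightarrow> Least P \<le> r"
    by (auto intro: LeastI Least_le)
  then have "matching_start A t (Least P)"
    using False unfolding matching_start_def P_def by (meson not_le)
  then show ?thesis ..
qed

lemma compatible_diagram_subset:
  "compatible_diagram n \<Sigma> \<Longrightarrow> \<Sigma>' \<subseteq> \<Sigma> \<Longrightarrow> compatible_diagram n \<Sigma>'"
  by (auto simp: compatible_diagram_def subset_iff)

lemma finite_arcs: "finite (arcs n)"
proof (rule finite_subset)
  show "arcs n \<subseteq> (\<lambda>(l, u, R). Arc l u R) ` ({..n + 1} \<times> {..n + 1} \<times> Pow {..n + 1})"
  proof
    fix a assume a: "a \<in> arcs n"
    have "passed_right a \<subseteq> {..n + 1}"
      using arcsD[OF a] by (auto simp: intermediate_def)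
    then have "(lower a, upper a, passed_right a) \<in> {..n + 1} \<times> {..n + 1} \<times> Pow {..n + 1}"
      using arcsD[OF a] by auto
    then show "a \<in> (\<lambda>(l, u, R). Arc l u R) ` ({..n + 1} \<times> {..n + 1} \<times> Pow {..n + 1})"
      by (rule rev_image_eqI) simp
  qed
qed auto

lemma compatible_diagram_finite: "compatible_diagram n \<Sigma> \<Longrightarrow> finite \<Sigma>"
  unfolding compatible_diagram_def using finite_arcs finite_subset by blast

text \<open>By minimality of \<open>t\<close> no arc ends below \<open>t + 1\<close>, so the arcs
  begun by \<open>t\<close> are still open when this one ends, and compatibility with each of them
  fixes the position of its lower endpoint.\<close>

lemma first_end:
  assumes D: "compatible_diagram n \<Sigma>"
    and t: "t \<in> val (\<not> e) ` \<Sigma>" "\<And>t'. t' \<in> val (\<not> e) ` \<Sigma> \<Longrightarrow> t \<le> t'"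
    and m: "m \<in> val e ` \<Sigma>" "m \<le> t"
  shows "\<exists>a\<in>\<Sigma>. alt e a \<and> upper a = Suc t \<and> matching_start (val e ` \<Sigma>) t (lower a)"
proof -
  have arcs: "1 \<le> lower a" "lower a < upper a" if "a \<in> \<Sigma>" for a
    using D that arcsD[of a n] by (auto simp: compatible_diagram_def)
  have comp: "compatible a b" if "a \<in> \<Sigma>" "b \<in> \<Sigma>" "a \<noteq> b" for a b
    using D that by (auto simp: compatible_diagram_def)
  have tmin: "t \<le> val (\<not> e) a" if "a \<in> \<Sigma>" for a using t(2) that by blast
  \<comment> \<open>An arc \<open>b\<close> not of kind \<open>e\<close> would have
    \<open>lower b \<ge> t\<close> and \<open>upper b \<le> t + 1\<close>. It would then overlap
    \<open>a\<close> with the opposite kind, hence equal \<open>a\<close>.\<close>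
  have start: "alt e b" if b: "b \<in> \<Sigma>" "val e b \<le> t" and ex: "a \<in> \<Sigma>" "lower a \<le> t" "t < upper a"
    "alt e a" for a b
    using D b(1)
  proof (cases rule: alt_cases[where e = e])
    case 2
    then have "lower b = t" "upper b = Suc t" using b arcs[OF b(1)] tmin[OF b(1)] by auto
    then have "\<not> (upper a \<le> lower b \<or> upper b \<le> lower a)" using ex by auto
    then have "a = b"
      using opposite_disjoint[OF comp[OF ex(1) b(1)] ex(4) 2(2)] by blast
    then show ?thesis using ex by simp
  qed
  obtain c where c: "c \<in> \<Sigma>" "val (\<not> e) c = t" using t(1) by blast
  have "\<exists>a\<in>\<Sigma>. alt e a \<and> upper a = Suc t"
    using D c(1)
  proof (cases rule: alt_cases[where e = e])
    case 1
    then show ?thesis using c arcs[OF c(1)] by (intro bexI[of _ c]) auto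
  next
    \<comment> \<open>This case is impossible: \<open>c\<close> starts at \<open>t\<close>, and the
      arc contributing \<open>m \<le> t\<close> would overlap \<open>c\<close> or share its lower
      endpoint, so it is \<open>c\<close> itself. Then \<open>c\<close> joins \<open>t\<close> and
      \<open>t + 1\<close> and is of both kinds.\<close>
    case lc: 2
    obtain b where b: "b \<in> \<Sigma>" "val e b = m" using m(1) by blast
    from D b(1) have "b = c"
    proof (cases rule: alt_cases[where e = e])
      case 1
      then have "lower b \<le> t" "t < upper b" using b m tmin[OF b(1)] arcs[OF b(1)] by auto
      then have "\<not> (upper b \<le> lower c \<or> upper c \<le> lower b)" using lc c arcs[OF c(1)] by auto
      then show ?thesis
        using opposite_disjoint[OF comp[OF b(1) c(1)] 1(1) lc(2)] by blast
    next
      case 2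
      then have "lower b = t" using b m arcs[OF b(1)] tmin[OF b(1)] by auto
      then show ?thesis
        using comp[OF b(1) c(1)] lc c by (auto simp: compatible_def)
    qed
    then have "upper c = Suc (lower c)" using lc c b m arcs[OF c(1)] by auto
    then have "alt e c" by (auto simp: alt_def intermediate_def)
    then show ?thesis using lc by simp
  qed
  then obtain a where a: "a \<in> \<Sigma>" "alt e a" "upper a = Suc t" by blast
  have la: "lower a \<le> t" using arcs[OF a(1)] a(3) by simp
  have va: "val e a = lower a" using a(2) by (simp add: val_def)
  have "(r < lower a \<longrightarrow> even (lower a) \<noteq> even t) \<and> (lower a < r \<longrightarrow> even r = even t)"
    if r: "r \<in> val e ` \<Sigma>" "r \<le> t" for r
  proof (cases "r = lower a")
    case False
    obtain b where b: "b \<in> \<Sigma>" "val e b = r" using r by blast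
    have eb: "alt e b" using start[OF b(1) _ a(1) la _ a(2)] b r a by simp
    have lb: "lower b = r" using eb b by (simp add: val_def)
    have "a \<noteq> b" using False lb by auto
    then have cab: "compatible a b" "compatible b a" using comp a b by auto
    from D b(1) have "t \<le> upper b - 1"
      by (cases rule: alt_cases[where e = e]) (use eb tmin[OF b(1)] in auto)
    \<comment> \<open>So \<open>a\<close> ends before \<open>b\<close>, and the parity clauses refer
      to \<open>upper a = Suc t\<close>, of parity opposite to that of \<open>t\<close>.\<close>
    then have "upper b > Suc t"
      using compatible_upper[OF cab(1)] a(3) arcs[OF b(1)] by simp
    then show ?thesis
      using compatible_parity[OF cab(1) a(2) eb] compatible_parity[OF cab(2) eb a(2)] lb a(3) r la
      by auto
  qed simp
  then have "matching_start (val e ` \<Sigma>) t (lower a)"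
    unfolding matching_start_def using va a la by (metis imageI)
  then show ?thesis using a by blast
qed

lemma alt_arc_eqI:
  assumes "a \<in> arcs n" "b \<in> arcs n" "alt e a" "alt e b" "lower a = lower b" "upper a = upper b"
  shows "a = b"
proof -
  have "passed_right a = passed_right b"
    using assms(3-6) arcsD(4)[OF assms(1)] arcsD(4)[OF assms(2)]
    by (auto simp: alt_def intermediate_def)
  then show ?thesis using assms by (intro arc.expand) simp
qed

section \<open>Uniqueness by induction on the number of arcs\<close>

text \<open>This provides the hypotheses of \<open>first_end\<close>: \<open>e\<close> is the index
  of the set with the smaller minimum, and \<open>t\<close> is the minimum of the other set.\<close>

lemma ex_min_kind:
  fixes F :: "bool \<Rightarrow> nat set"
  assumes "\<And>e. finite (F e)" "\<And>e. F e \<noteq> {}"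
  obtains e m t where "m \<in> F e" "t \<in> F (\<not> e)" "m \<le> t" "\<And>t'. t' \<in> F (\<not> e) \<Longrightarrow> t \<le> t'"
proof -
  define e where "e \<longleftrightarrow> Min (F True) \<le> Min (F False)"
  have "Min (F e) \<le> Min (F (\<not> e))" by (cases e) (auto simp: e_def)
  then show thesis
    using assms by (intro that[of "Min (F e)" e "Min (F (\<not> e))"]) auto
qed

lemma val_image_remove:
  assumes "compatible_diagram n \<Sigma>" "a \<in> \<Sigma>"
  shows "val e ` (\<Sigma> - {a}) = val e ` \<Sigma> - {val e a}"
  using inj_on_image_set_diff[OF inj_on_val[OF assms(1)], of \<Sigma> "{a}" e] assms(2) by simp

text \<open>Both diagrams contain the arc found by \<open>first_end\<close>, since its kind and
  endpoints depend only on the value sets; it is removed from both.\<close>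

lemma compatible_diagram_unique:
  assumes "compatible_diagram n \<Sigma>" "compatible_diagram n \<Sigma>'" "\<And>e. val e ` \<Sigma> = val e ` \<Sigma>'"
  shows "\<Sigma> = \<Sigma>'"
  using assms
proof (induction "card \<Sigma>" arbitrary: \<Sigma> \<Sigma>')
  case 0
  then have "\<Sigma> = {}" using compatible_diagram_finite by auto
  then show ?case using "0.prems"(3)[of True] by auto
next
  case (Suc k)
  note D = Suc.prems(1) and D' = Suc.prems(2) and eq = Suc.prems(3)
  have fin: "finite \<Sigma>" using D by (rule compatible_diagram_finite)
  have "\<Sigma> \<noteq> {}" using Suc.hyps(2) by auto
  then obtain e m t where *: "m \<in> val e ` \<Sigma>" "t \<in> val (\<not> e) ` \<Sigma>" "m \<le> t"
    "\<And>t'. t' \<in> val (\<not> e) ` \<Sigma> \<Longrightarrow> t \<le> t'"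
    using ex_min_kind[of "\<lambda>e. val e ` \<Sigma>"] fin by (metis finite_imageI image_is_empty)
  obtain a where a: "a \<in> \<Sigma>" "alt e a" "upper a = Suc t" "matching_start (val e ` \<Sigma>) t (lower a)"
    using first_end[OF D *(2,4,1,3)] by blast
  obtain b where b: "b \<in> \<Sigma>'" "alt e b" "upper b = Suc t" "matching_start (val e ` \<Sigma>) t (lower b)"
    using first_end[OF D', of t e m] * unfolding eq by blast
  have "a \<in> arcs n" "b \<in> arcs n"
    using D D' a(1) b(1) by (auto simp: compatible_diagram_def)
  then have ab: "a = b"
    using alt_arc_eqI a b matching_start_unique by metis
  have "\<Sigma> - {a} = \<Sigma>' - {a}"
  proof (rule Suc.hyps(1))
    show "k = card (\<Sigma> - {a})" using Suc.hyps(2) a(1) fin by simp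
    show "compatible_diagram n (\<Sigma> - {a})" "compatible_diagram n (\<Sigma>' - {a})"
      using D D' compatible_diagram_subset by blast+
    show "val f ` (\<Sigma> - {a}) = val f ` (\<Sigma>' - {a})" for f
      using val_image_remove[OF D a(1)] val_image_remove[OF D'] b(1) ab eq by simp
  qed
  then show ?case using a(1) b(1) ab by blast
qed

section \<open>Existence by adding the arc that ends first\<close>

text \<open>Converse of the parity computation in \<open>first_end\<close>: the hypotheses on parity
  are those of \<open>matching_start\<close> for \<open>lower a\<close>.\<close>

lemma compatible_first_end:
  assumes a: "alt e a" "lower a \<le> t" "upper a = Suc t"
    and b: "lower b < upper b" "alt e b \<or> t < lower b" "lower b \<noteq> lower a" "Suc t < upper b"
    and r: "lower b \<le> t \<Longrightarrow> lower b < lower a \<Longrightarrow> even (lower a) \<noteq> even t"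
      "lower b \<le> t \<Longrightarrow> lower a < lower b \<Longrightarrow> even (lower b) = even t"
  shows "compatible a b" "compatible b a"
proof -
  \<comment> \<open>If the ranges overlap, \<open>b\<close> starts by \<open>t\<close> and so has
    kind \<open>e\<close>; hence one of the two arcs is of both kinds and short. For
    \<open>b\<close> this contradicts \<open>Suc t < upper b\<close>; for \<open>a\<close> it gives
    \<open>lower a = t\<close>, against the parity hypotheses.\<close>
  have opp: "upper a \<le> lower b" if f: "alt f a" "alt (\<not> f) b" for f
  proof (rule ccontr)
    assume "\<not> upper a \<le> lower b"
    then have lb: "lower b \<le> t" and eb: "alt e b" using a b by auto
    show False
    proof (cases "f = e")
      case True
      then have "upper b \<le> Suc (lower b)" using f eb alt_both by blast
      then show False using lb b by simp
    next
      case False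
      then have "alt (\<not> e) a" using f by (cases e; cases f) simp_all
      then have "upper a \<le> Suc (lower a)" using a alt_both by blast
      then have "lower a = t" using a by simp
      then show False using r lb b by (cases "lower b" "lower a" rule: linorder_cases) auto
    qed
  qed
  have "\<And>f. alt f b \<Longrightarrow> alt (\<not> f) a \<Longrightarrow> upper a \<le> lower b"
    using opp[of "\<not> f" for f] by simp
  then show "compatible a b" "compatible b a"
    using opp a b r unfolding compatible_def by auto
qed

text \<open>A matched pair is removed from the two sets, and its arc is added to the diagram for the
  rest. Indexing the sets by the kind lets \<open>e\<close> be either kind in the induction
  step.\<close>

lemma compatible_diagram_exists:
  assumes "\<And>e. F e \<subseteq> {1..n}" "card (F True) = card (F False)"
  shows "\<exists>\<Sigma>. compatible_diagram n \<Sigma> \<and> (\<forall>e. val e ` \<Sigma> = F e)"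
  using assms
proof (induction "card (F True)" arbitrary: F)
  case 0
  have "finite (F e)" for e using "0.prems"(1) finite_subset by blast
  then have "F e = {}" for e using 0 by (cases e) auto
  then show ?case by (intro exI[of _ "{}"]) (simp add: compatible_diagram_def)
next
  case (Suc k)
  have fin: "finite (F e)" for e using Suc.prems(1) finite_subset by blast
  have card: "card (F e) = Suc k" for e using Suc by (cases e) auto
  have ne: "F e \<noteq> {}" for e using card[of e] by auto
  then obtain e m t where t: "m \<in> F e" "t \<in> F (\<not> e)" "m \<le> t"
    "\<And>t'. t' \<in> F (\<not> e) \<Longrightarrow> t \<le> t'"
    using ex_min_kind[of F, OF fin ne] by metis
  obtain s where "matching_start (F e) t s" using matching_start_exists t by blast
  then have s: "s \<in> F e" "s \<le> t"
    and r: "\<And>r. r \<in> F e \<Longrightarrow> r \<le> t \<Longrightarrow> r < s \<Longrightarrow> even s \<noteq> even t"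
      "\<And>r. r \<in> F e \<Longrightarrow> r \<le> t \<Longrightarrow> s < r \<Longrightarrow> even r = even t"
    by (auto simp: matching_start_def)
  define a where "a = Arc s (Suc t) {p \<in> {s<..<Suc t}. even p = e}"
  have "1 \<le> s" "t \<le> n" using Suc.prems(1)[of e] Suc.prems(1)[of "\<not> e"] s t by auto
  then have a: "a \<in> arcs n" "alt e a" "lower a = s" "upper a = Suc t"
    using s by (auto simp: a_def arcs_def alt_def intermediate_def)
  define G where "G f = F f - {val f a}" for f
  have va: "val e a = s" "val (\<not> e) a = t" using val_alt[OF a(1,2)] a by auto
  have inF: "val f a \<in> F f" for f using va s t by (cases "f = e") auto
  have "card (G f) = k" for f using card[of f] inF[of f] fin[of f] by (simp add: G_def)
  moreover have "G f \<subseteq> {1..n}" for f using Suc.prems(1) by (auto simp: G_def)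
  ultimately obtain \<Sigma> where D: "compatible_diagram n \<Sigma>" and v: "\<And>f. val f ` \<Sigma> = G f"
    using Suc.hyps(1)[of G] by auto
  have "compatible a b \<and> compatible b a" if b: "b \<in> \<Sigma>" for b
  proof -
    have "b \<in> arcs n" using D b by (auto simp: compatible_diagram_def)
    then have lb: "lower b < upper b" using arcsD by blast
    have "val f b \<in> G f" for f using v b by blast
    \<comment> \<open>Since \<open>t\<close> is minimal in \<open>F (\<not> e)\<close> and missing
      from \<open>G (\<not> e)\<close>, the inequality for \<open>b\<close> is strict.\<close>
    from this[of e] this[of "\<not> e"] have vb: "val e b \<in> F e" "val e b \<noteq> s" "t < val (\<not> e) b"
      using va t(4) by (auto simp: G_def order_less_le)
    \<comment> \<open>An arc of kind \<open>e\<close> ends above \<open>t + 1\<close> because its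
      last gap exceeds \<open>t\<close>; one that is only of the other kind starts above
      \<open>t\<close>.\<close>
    from D b have "(alt e b \<and> lower b \<in> F e \<or> t < lower b) \<and> lower b \<noteq> s \<and> Suc t < upper b"
      by (cases rule: alt_cases[where e = e]) (use vb lb s in auto)
    then show ?thesis
      using compatible_first_end[OF a(2) _ a(4) lb] a(3) s r[of "lower b"] by auto
  qed
  then have "compatible_diagram n (insert a \<Sigma>)"
    using D a(1,2) unfolding compatible_diagram_def by auto
  moreover have "val f ` insert a \<Sigma> = F f" for f
    using v[of f] inF[of f] by (auto simp: G_def)
  ultimately show ?case by blast
qed

section \<open>The bijection and its restriction to diagrams with \<open>k\<close> arcs\<close>

lemma card_val: "compatible_diagram n \<Sigma> \<Longrightarrow> card (val e ` \<Sigma>) = card \<Sigma>"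
  by (rule card_image) (rule inj_on_val)

theorem theorem3p8:
  fixes n :: nat
  shows "bij_betw pi_map (alternating_arc_diagrams n)
           {(S, T). S \<subseteq> {1..n} \<and> T \<subseteq> {1..n} \<and> card S = card T}
       \<and> (\<forall>k. bij_betw pi_map {\<Sigma> \<in> alternating_arc_diagrams n. card \<Sigma> = k}
           {(S, T). S \<subseteq> {1..n} \<and> T \<subseteq> {1..n} \<and> card S = k \<and> card T = k})"
proof -
  let ?A = "alternating_arc_diagrams n"
  have pi: "pi_map \<Sigma> = (val True ` \<Sigma>, val False ` \<Sigma>)" if "\<Sigma> \<in> ?A" for \<Sigma>
    using that pi_map_eq by (simp add: alternating_arc_diagrams_iff)
  have range: "val e ` \<Sigma> \<subseteq> {1..n}" and card: "card (val e ` \<Sigma>) = card \<Sigma>"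
    if "\<Sigma> \<in> ?A" for \<Sigma> e
  proof -
    have D: "compatible_diagram n \<Sigma>" using that by (simp add: alternating_arc_diagrams_iff)
    then have "\<Sigma> \<subseteq> arcs n" by (simp add: compatible_diagram_def)
    then show "val e ` \<Sigma> \<subseteq> {1..n}" using val_range by blast
    show "card (val e ` \<Sigma>) = card \<Sigma>" using D by (rule card_val)
  qed
  have inj: "inj_on pi_map ?A"
  proof (rule inj_onI)
    fix \<Sigma> \<Sigma>' assume S: "\<Sigma> \<in> ?A" "\<Sigma>' \<in> ?A" "pi_map \<Sigma> = pi_map \<Sigma>'"
    then have "val e ` \<Sigma> = val e ` \<Sigma>'" for e by (cases e) (simp_all add: pi)
    then show "\<Sigma> = \<Sigma>'"
      using S compatible_diagram_unique by (simp add: alternating_arc_diagrams_iff)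
  qed
  have surj: "\<exists>\<Sigma>\<in>?A. pi_map \<Sigma> = (S, T)"
    if "S \<subseteq> {1..n}" "T \<subseteq> {1..n}" "card S = card T" for S T
  proof -
    note ST = that
    have "(if e then S else T) \<subseteq> {1..n}" for e using ST by simp
    then obtain \<Sigma> where D: "compatible_diagram n \<Sigma>"
      and v: "\<forall>e. val e ` \<Sigma> = (if e then S else T)"
      using compatible_diagram_exists[of "\<lambda>e. if e then S else T" n] ST(3) by auto
    have "pi_map \<Sigma> = (S, T)" using pi_map_eq[OF D] v by simp
    then show ?thesis using D alternating_arc_diagrams_iff by blast
  qed
  have im: "pi_map ` ?A = {(S, T). S \<subseteq> {1..n} \<and> T \<subseteq> {1..n} \<and> card S = card T}"
  proof (intro equalityI subsetI)
    fix x assume "x \<in> pi_map ` ?A"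
    then obtain \<Sigma> where "\<Sigma> \<in> ?A" "x = pi_map \<Sigma>" by blast
    then show "x \<in> {(S, T). S \<subseteq> {1..n} \<and> T \<subseteq> {1..n} \<and> card S = card T}"
      using range card by (simp add: pi)
  next
    fix x assume "x \<in> {(S, T). S \<subseteq> {1..n} \<and> T \<subseteq> {1..n} \<and> card S = card T}"
    then obtain S T where "x = (S, T)" "S \<subseteq> {1..n}" "T \<subseteq> {1..n}" "card S = card T" by blast
    then have "\<exists>\<Sigma>\<in>?A. pi_map \<Sigma> = x" using surj by blast
    then show "x \<in> pi_map ` ?A" by blast
  qed
  have imk: "pi_map ` {\<Sigma> \<in> ?A. card \<Sigma> = k} =
      {(S, T). S \<subseteq> {1..n} \<and> T \<subseteq> {1..n} \<and> card S = k \<and> card T = k}" for k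
  proof (intro equalityI subsetI)
    fix x assume "x \<in> pi_map ` {\<Sigma> \<in> ?A. card \<Sigma> = k}"
    then obtain \<Sigma> where "\<Sigma> \<in> ?A" "card \<Sigma> = k" "x = pi_map \<Sigma>" by blast
    then show "x \<in> {(S, T). S \<subseteq> {1..n} \<and> T \<subseteq> {1..n} \<and> card S = k \<and> card T = k}"
      using range card by (simp add: pi)
  next
    fix x assume x: "x \<in> {(S, T). S \<subseteq> {1..n} \<and> T \<subseteq> {1..n} \<and> card S = k \<and> card T = k}"
    then obtain S T where "x = (S, T)" "S \<subseteq> {1..n}" "T \<subseteq> {1..n}" "card S = card T" by auto
    then have "\<exists>\<Sigma>\<in>?A. pi_map \<Sigma> = x" using surj by blast
    then obtain \<Sigma> where S: "\<Sigma> \<in> ?A" "pi_map \<Sigma> = x" by blast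
    \<comment> \<open>A preimage under the full bijection has \<open>k\<close> arcs automatically,
      as \<open>card \<Sigma>\<close> is the cardinality of either component.\<close>
    then have "card \<Sigma> = k" using x pi[OF S(1)] card[OF S(1), of True] by auto
    then show "x \<in> pi_map ` {\<Sigma> \<in> ?A. card \<Sigma> = k}" using S by blast
  qed
  have "inj_on pi_map {\<Sigma> \<in> ?A. card \<Sigma> = k}" for k
    using inj by (rule inj_on_subset) blast
  then show ?thesis
    by (simp add: bij_betw_def inj im imk)
qed

end
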